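(* Let $F\subset\mathbb R^d$ be a boundary set. Let $\mathbb P$ be a measure on $\mathbb R^d$ with density $f\ge0$ w.r.t. $\mu_d$, and suppose there is a bounded measurable function $\bar f\ge0$ on $F$ with $$\frac1\varepsilon\int_{\mathbb R^d}\mathbf 1\{d_F(z)\le\varepsilon\}\,|f(z)-\bar f(p_F(z))|\,\mu_d(dz)\to0\quad(\varepsilon\to0^+),$$ and such that $(x,u)\mapsto\bar f(x)$ is integrable with respect to $|\Theta_i|(F,\cdot)$ on $\mathrm{Nor}(F)$ for $i=0,\dots,d-1$. Define $\mathbb Q(d(s,x,u))=ds\times\bar f(x)\,\Theta_{d-1}(F,d(x,u))$ on $\Sigma(F)$. Let $T>0$ and let $F(\varepsilon)$, $0\le\varepsilon\le1$, be Borel sets with $F(0)\subset F$ and $F(\varepsilon)\subset F_{\varepsilon T}$, which are differentiable at $F$ with a derivative $B\subset\Sigma_T(F)$. Then $\lim_{\varepsilon\to0^+}\frac{\mathbb P(F(\varepsilon))-\mathbb P(F(0))}{\varepsilon}$ exists and equals $\mathbb Q(B)$.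
   Context: Notation: $\mu_d$ is Lebesgue measure on $\mathbb R^d$, $\mu_1$ Lebesgue measure on $\mathbb R$, $S^{d-1}$ the unit sphere, $a\wedge b=\min(a,b)$. For a nonempty closed set $G\subset\mathbb R^d$ and $z\in\mathbb R^d$: $d_G(z)=\min_{x\in G}\|z-x\|$; the skeleton $S_G$ is the set of points having more than one nearest point in $G$; for $z\notin S_G$, $p_G(z)$ is the unique nearest point; for $z\notin S_G\cup G$, $u_G(z)=(z-p_G(z))/d_G(z)$. The normal bundle is $\mathrm{Nor}(G)=\{(p_G(z),u_G(z)):z\in\mathbb R^d\setminus(S_G\cup G)\}\subset\partial G\times S^{d-1}$ and the reach function is $r_G(x,u)=\sup\{s>0:p_G(x+su)=x\}\in(0,\infty]$. For $\varepsilon>0$, $G_\varepsilon=\{z:d_G(z)\le\varepsilon\}$. Support measures (Hug–Last–Weil local Steiner formula): there are uniquely determined set functions $\Theta_0(G,\cdot),\dots,\Theta_{d-1}(G,\cdot)$, defined on Borel sets $A\subset\mathrm{Nor}(G)$ contained in some $\{(x,u):\max(\|x\|,r_G(x,u)^{-1})\le c\}$, $c<\infty$, which are signed measures of finite variation on each such sublevel set, whose total variation measures $|\Theta_i|(G,\cdot)$ (extended to all Borel subsets of $\mathrm{Nor}(G)$) satisfy $\int\mathbf 1_K(x)(r_G(x,u)\wedge c)^{d-i}|\Theta_i|(G,d(x,u))<\infty$ for all compact $K$ and $c>0$, and such that for every bounded measurable $f$ with compact support $\int_{\mathbb R^d\setminus G}f\,d\mu_d=\sum_{j=1}^d\binom{d-1}{j-1}\int_{\mathrm{Nor}(G)}\int_0^{r_G(x,u)}f(x+tu)t^{j-1}\,dt\,\Theta_{d-j}(G,d(x,u))$.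 $\Theta_{d-1}(G,\cdot)$ is a nonnegative $\sigma$-finite measure. Boundary sets: a boundary set is a nonempty compact $F\subset\mathbb R^d$ with empty interior and $\mu_d(F)=0$. Its normal cylinder is $\Sigma(F)=\mathbb R\times\mathrm{Nor}(F)$, $\Sigma_T(F)=\{(t,x,u)\in\Sigma(F):|t|\le T\}$, and $M_F=\mu_1\otimes\Theta_{d-1}(F,\cdot)$. For $\varepsilon>0$ the local magnification map is $\tau_\varepsilon(z)=(d_F(z)/\varepsilon,p_F(z),u_F(z))$ for $z\notin F\cup S_F$, and $\tau_\varepsilon(A)=\{\tau_\varepsilon(z):z\in A\setminus(F\cup S_F)\}$ for Borel $A$. A family $F(\varepsilon)$, $0\le\varepsilon\le1$, of bounded Borel sets with $F(0)\subset F$ is differentiable at $F$ with derivative $B$ (a Borel subset of $\Sigma(F)$) if there is $T>0$ with $\varepsilon^{-1}\mu_d(F(\varepsilon)\setminus F_{\varepsilon T})\to0$ and $M_F(\tau_\varepsilon(F(\varepsilon))\triangle B)\to0$ as $\varepsilon\to0^+$. *)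

theory Defs
  imports "HOL-Analysis.Analysis"
begin

definition skel :: "'a::euclidean_space set \<Rightarrow> 'a set" where
  "skel G = {z. \<exists>x y. x \<in> G \<and> y \<in> G \<and> x \<noteq> y \<and>
                   dist z x = infdist z G \<and> dist z y = infdist z G}"

definition proj :: "'a::euclidean_space set \<Rightarrow> 'a \<Rightarrow> 'a" where
  "proj G z = (THE x. x \<in> G \<and> dist z x = infdist z G)"

definition udir :: "'a::euclidean_space set \<Rightarrow> 'a \<Rightarrow> 'a" where
  "udir G z = (z - proj G z) /\<^sub>R infdist z G"

definition Nor :: "'a::euclidean_space set \<Rightarrow> ('a \<times> 'a) set" where
  "Nor G = {(proj G z, udir G z) | z. z \<notin> skel G \<union> G}"

definition reach :: "'a::euclidean_space set \<Rightarrow> 'a \<times> 'a \<Rightarrow> ereal" where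
  "reach G xu = (case xu of (x, u) \<Rightarrow>
      Sup {ereal s | s. s > 0 \<and> x + s *\<^sub>R u \<notin> skel G \<and> proj G (x + s *\<^sub>R u) = x})"

definition parallel_set :: "'a::euclidean_space set \<Rightarrow> real \<Rightarrow> 'a set" where
  "parallel_set G e = {z. infdist z G \<le> e}"

definition sublevel :: "'a::euclidean_space set \<Rightarrow> real \<Rightarrow> ('a \<times> 'a) set" where
  "sublevel G c = {(x, u) \<in> Nor G. norm x \<le> c \<and> ereal (1 / c) \<le> reach G (x, u)}"

section \<open>Support measures (Hug--Last--Weil), via Jordan decomposition\<close>

text \<open>Thp i and Thn i are the positive and negative parts of Theta_i(G,.), measures on
  Nor G with the trace of the Borel sigma-algebra; |Theta_i| = Thp i + Thn i.\<close>

definition support_measures ::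
  "'a::euclidean_space set \<Rightarrow> (nat \<Rightarrow> ('a \<times> 'a) measure) \<Rightarrow> (nat \<Rightarrow> ('a \<times> 'a) measure) \<Rightarrow> bool" where
  "support_measures G Thp Thn \<longleftrightarrow>
     (\<forall>i < DIM('a).
        sets (Thp i) = sets (restrict_space borel (Nor G)) \<and>
        sets (Thn i) = sets (restrict_space borel (Nor G)) \<and>
        (\<exists>A \<in> sets (Thp i). emeasure (Thp i) A = 0 \<and> emeasure (Thn i) (Nor G - A) = 0) \<and>
        (\<forall>c > 0. emeasure (Thp i) (sublevel G c) < \<infinity> \<and> emeasure (Thn i) (sublevel G c) < \<infinity>) \<and>
        (\<forall>K c. compact K \<and> c > 0 \<longrightarrow>
            (\<integral>\<^sup>+ xu. ennreal (indicator K (fst xu) *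
                 real_of_ereal (min (reach G xu) (ereal c)) ^ (DIM('a) - i)) \<partial>Thp i) < \<infinity> \<and>
            (\<integral>\<^sup>+ xu. ennreal (indicator K (fst xu) *
                 real_of_ereal (min (reach G xu) (ereal c)) ^ (DIM('a) - i)) \<partial>Thn i) < \<infinity>)) \<and>
     (\<forall>A. emeasure (Thn (DIM('a) - 1)) A = 0) \<and>
     (\<forall>g :: 'a \<Rightarrow> real. g \<in> borel_measurable borel \<and> bounded (range g) \<and> bounded {z. g z \<noteq> 0} \<longrightarrow>
        (\<integral> z. indicator (- G) z * g z \<partial>lebesgue) =
        (\<Sum>j = 1..DIM('a). real (DIM('a) - 1 choose (j - 1)) *
            ((\<integral> xu. (LINT t : {t. 0 < t \<and> ereal t < reach G xu} | lborel.
                        g (fst xu + t *\<^sub>R snd xu) * t ^ (j - 1)) \<partial>Thp (DIM('a) - j)) -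
             (\<integral> xu. (LINT t : {t. 0 < t \<and> ereal t < reach G xu} | lborel.
                        g (fst xu + t *\<^sub>R snd xu) * t ^ (j - 1)) \<partial>Thn (DIM('a) - j)))))"

definition boundary_set :: "'a::euclidean_space set \<Rightarrow> bool" where
  "boundary_set F \<longleftrightarrow> F \<noteq> {} \<and> compact F \<and> interior F = {} \<and> emeasure lborel F = 0"

definition normal_cylinder :: "'a::euclidean_space set \<Rightarrow> (real \<times> 'a \<times> 'a) set" where
  "normal_cylinder F = UNIV \<times> Nor F"

definition normal_cylinder_T :: "'a::euclidean_space set \<Rightarrow> real \<Rightarrow> (real \<times> 'a \<times> 'a) set" where
  "normal_cylinder_T F T = {(t, x, u). \<bar>t\<bar> \<le> T \<and> (x, u) \<in> Nor F}"

definition magnify :: "'a::euclidean_space set \<Rightarrow> real \<Rightarrow> 'a set \<Rightarrow> (real \<times> 'a \<times> 'a) set" where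
  "magnify F e A = {(infdist z F / e, proj F z, udir F z) | z. z \<in> A \<and> z \<notin> F \<union> skel F}"

text \<open>M_F = Lebesgue measure on R times Theta_{d-1}(F,.), where Thp is the family of
  (positive parts of the) support measures of F.\<close>

definition set_differentiable ::
  "'a::euclidean_space set \<Rightarrow> (nat \<Rightarrow> ('a \<times> 'a) measure) \<Rightarrow> (real \<Rightarrow> 'a set) \<Rightarrow> (real \<times> 'a \<times> 'a) set \<Rightarrow> bool" where
  "set_differentiable F Thp Fam B \<longleftrightarrow>
     (\<forall>e \<in> {0..1}. bounded (Fam e) \<and> Fam e \<in> sets borel) \<and> Fam 0 \<subseteq> F \<and>
     B \<in> sets (lborel \<Otimes>\<^sub>M Thp (DIM('a) - 1)) \<and> B \<subseteq> normal_cylinder F \<and>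
     (\<exists>T > 0.
        ((\<lambda>e. emeasure lebesgue (Fam e - parallel_set F (e * T)) / ennreal e) \<longlongrightarrow> 0) (at_right 0) \<and>
        ((\<lambda>e. emeasure (lborel \<Otimes>\<^sub>M Thp (DIM('a) - 1)) (magnify F e (Fam e) \<union> B - magnify F e (Fam e) \<inter> B))
            \<longlongrightarrow> 0) (at_right 0))"

end

theory Submission
  imports Defs
begin

text \<open>
  Since \<open>f\<close> is close to \<open>fbar \<circ> proj F\<close> on \<open>parallel_set F (e * T)\<close>, it suffices to integrate
  \<open>fbar \<circ> proj F\<close> over \<open>Fam e\<close>. The local Steiner formula splits this integral into summands
  \<open>j = 1, \<dots>, d\<close>. Only points at distance at most \<open>e * T\<close> contribute, so the \<open>j\<close>-th summand is
  \<open>O(e ^ j)\<close> by integrability of \<open>fbar\<close> with respect to the support measures, and those with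
  \<open>j \<ge> 2\<close> vanish after division by \<open>e\<close>. Rescaling the distance by \<open>e\<close> turns the summand \<open>j = 1\<close>,
  divided by \<open>e\<close>, into the integral of \<open>fbar\<close> over the magnified set \<open>magnify F e (Fam e)\<close>. As \<open>fbar\<close> is
  bounded on \<open>F\<close>, this converges to the integral over \<open>B\<close>. That the skeleton is a null set also follows
  from the Steiner formula, because the segments parametrised there avoid it.
\<close>

section \<open>Nearest points, reach and skeleton\<close>

lemma proj_eqI:
  assumes "z \<notin> skel G" "x \<in> G" "dist z x = infdist z G"
  shows "proj G z = x"
  unfolding proj_def using assms by (intro the_equality) (auto simp: skel_def)

lemma proj_nearest:
  assumes "closed G" "G \<noteq> {}" "z \<notin> skel G"
  shows "proj G z \<in> G" "dist z (proj G z) = infdist z G"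
proof -
  obtain x where x: "x \<in> G" "infdist z G = dist z x"
    using infdist_attains_inf[OF assms(1,2)] by metis
  with proj_eqI[OF assms(3) x(1)] show "proj G z \<in> G" "dist z (proj G z) = infdist z G"
    by auto
qed

lemma infdist_pos:
  assumes "closed G" "G \<noteq> {}" "z \<notin> G"
  shows "0 < infdist z G"
  using assms in_closed_iff_infdist_zero[of G z] infdist_nonneg[of z G] by linarith

text \<open>The distance function is 1-Lipschitz, so moving back from
  \<open>x + s *\<^sub>R u\<close> by \<open>s - t\<close> costs at most \<open>s - t\<close>; the
  point \<open>x\<close> itself gives the opposite bound.\<close>

lemma infdist_shrink:
  assumes "x \<in> G" "norm u = 1" "infdist (x + s *\<^sub>R u) G = s" "0 \<le> t" "t \<le> s"
  shows "infdist (x + t *\<^sub>R u) G = t"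
proof (rule antisym)
  show "infdist (x + t *\<^sub>R u) G \<le> t"
    using infdist_le[OF assms(1), of "x + t *\<^sub>R u"] assms by (simp add: dist_norm)
  have "dist (x + s *\<^sub>R u) (x + t *\<^sub>R u) = norm ((s - t) *\<^sub>R u)"
    by (simp add: dist_norm algebra_simps)
  then have "dist (x + s *\<^sub>R u) (x + t *\<^sub>R u) = s - t" using assms by simp
  then show "t \<le> infdist (x + t *\<^sub>R u) G"
    using infdist_triangle[of "x + s *\<^sub>R u" G "x + t *\<^sub>R u"] assms by simp
qed

text \<open>\<open>G\<close> misses the open ball of radius \<open>s\<close> about the far point,
  and the closed ball of radius \<open>t\<close> lies inside that ball except for the contact point
  \<open>x\<close>. This is where \<open>t < s\<close> enters.\<close>

lemma ray_proj:
  assumes "x \<in> G" "norm u = 1" "infdist (x + s *\<^sub>R u) G = s" "0 < t" "t < s"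
  shows "x + t *\<^sub>R u \<notin> skel G" "x + t *\<^sub>R u \<notin> G" "proj G (x + t *\<^sub>R u) = x"
    "infdist (x + t *\<^sub>R u) G = t"
proof -
  let ?z = "x + t *\<^sub>R u"
  show inf: "infdist ?z G = t" using infdist_shrink[OF assms(1-3)] assms(4,5) by simp
  then show "?z \<notin> G" using assms(4) by (metis infdist_zero less_irrefl)
  \<comment> \<open>a second nearest point would give equality in the triangle inequality\<close>
  have uniq: "y = x" if y: "y \<in> G" "dist ?z y = infdist ?z G" for y
  proof -
    let ?b = "?z - y"
    have nb: "norm ?b = t" using y inf by (simp add: dist_norm)
    have na: "norm ((s - t) *\<^sub>R u) = s - t" using assms by simp
    have eq: "(s - t) *\<^sub>R u + ?b = (x + s *\<^sub>R u) - y" by (simp add: algebra_simps)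
    have "s \<le> norm ((s - t) *\<^sub>R u + ?b)"
      unfolding eq using infdist_le[OF y(1), of "x + s *\<^sub>R u"] assms(3) by (simp add: dist_norm)
    then have "norm ((s - t) *\<^sub>R u + ?b) = norm ((s - t) *\<^sub>R u) + norm ?b"
      using norm_triangle_ineq[of "(s - t) *\<^sub>R u" ?b] na nb by linarith
    then have "norm ((s - t) *\<^sub>R u) *\<^sub>R ?b = norm ?b *\<^sub>R (s - t) *\<^sub>R u"
      by (simp only: norm_triangle_eq)
    then have "(s - t) *\<^sub>R ?b = t *\<^sub>R (s - t) *\<^sub>R u" by (simp only: na nb)
    then have "(s - t) *\<^sub>R (x - y) = 0" by (simp add: algebra_simps)
    then show "y = x" using assms by simp
  qed
  show sk: "?z \<notin> skel G" using uniq unfolding skel_def by blast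
  show "proj G ?z = x"
    by (rule proj_eqI[OF sk assms(1)]) (use inf assms in \<open>simp add: dist_norm\<close>)
qed

lemma udir_props:
  assumes "closed G" "G \<noteq> {}" "z \<notin> skel G" "z \<notin> G"
  shows "norm (udir G z) = 1" "z = proj G z + infdist z G *\<^sub>R udir G z"
  using proj_nearest[OF assms(1-3)] infdist_pos[OF assms(1,2,4)]
  by (auto simp: udir_def dist_norm)

lemma NorE:
  assumes "closed G" "G \<noteq> {}" "(x, u) \<in> Nor G"
  obtains s where "s > 0" "x + s *\<^sub>R u \<notin> skel G" "x + s *\<^sub>R u \<notin> G"
    "infdist (x + s *\<^sub>R u) G = s" "x \<in> G" "norm u = 1"
proof -
  obtain z where z: "x = proj G z" "u = udir G z" "z \<notin> skel G" "z \<notin> G"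
    using assms(3) by (auto simp: Nor_def)
  have eq: "x + infdist z G *\<^sub>R u = z" using udir_props(2)[OF assms(1,2) z(3,4)] z(1,2) by simp
  show ?thesis
    by (rule that[of "infdist z G"])
      (use eq z infdist_pos[OF assms(1,2) z(4)] proj_nearest(1)[OF assms(1,2) z(3)]
        udir_props(1)[OF assms(1,2) z(3,4)] in auto)
qed

lemma infdist_of_proj:
  assumes "closed G" "G \<noteq> {}" "norm u = 1" "s > 0" "x + s *\<^sub>R u \<notin> skel G" "proj G (x + s *\<^sub>R u) = x"
  shows "infdist (x + s *\<^sub>R u) G = s" "x \<in> G"
  using proj_nearest[OF assms(1,2,5)] assms by (auto simp: dist_norm)

text \<open>By \<open>ray_proj\<close> a witness in \<open>reach\<close> settles all smaller
  distances, and a witness beyond \<open>t\<close> exists even if the supremum is not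
  attained.\<close>

lemma reach_ray:
  assumes "closed G" "G \<noteq> {}" "(x, u) \<in> Nor G" "0 < t" "ereal t < reach G (x, u)"
  shows "x + t *\<^sub>R u \<notin> skel G" "x + t *\<^sub>R u \<notin> G" "proj G (x + t *\<^sub>R u) = x"
    "infdist (x + t *\<^sub>R u) G = t"
proof -
  have xu: "x \<in> G" "norm u = 1" using NorE[OF assms(1-3)] by metis+
  obtain s where s: "s > 0" "x + s *\<^sub>R u \<notin> skel G" "proj G (x + s *\<^sub>R u) = x" "t < s"
    using assms(5) unfolding reach_def prod.case less_Sup_iff mem_Collect_eq by fastforce
  have "infdist (x + s *\<^sub>R u) G = s" using infdist_of_proj[OF assms(1,2) xu(2) s(1-3)] by simp
  from ray_proj[OF xu this assms(4) s(4)]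
  show "x + t *\<^sub>R u \<notin> skel G" "x + t *\<^sub>R u \<notin> G" "proj G (x + t *\<^sub>R u) = x"
    "infdist (x + t *\<^sub>R u) G = t" by auto
qed

lemma reach_upper:
  assumes "0 < t" "x + t *\<^sub>R u \<notin> skel G" "proj G (x + t *\<^sub>R u) = x"
  shows "ereal t \<le> reach G (x, u)"
  unfolding reach_def using assms by (auto intro!: Sup_upper)

text \<open>Turns the supremum into an equation between continuous functions, whence measurability
  of \<open>sublevel\<close>. The bound is not strict: the distance identity persists at the reach
  itself, where the point may already lie in the skeleton.\<close>

lemma le_reach_iff:
  assumes "closed G" "G \<noteq> {}" "(x, u) \<in> Nor G" "0 < s"
  shows "ereal s \<le> reach G (x, u) \<longleftrightarrow> infdist (x + s *\<^sub>R u) G = s"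
proof
  have xu: "x \<in> G" "norm u = 1" using NorE[OF assms(1-3)] by metis+
  assume le: "ereal s \<le> reach G (x, u)"
  show "infdist (x + s *\<^sub>R u) G = s"
  proof (rule antisym)
    show "infdist (x + s *\<^sub>R u) G \<le> s"
      using infdist_le[OF xu(1), of "x + s *\<^sub>R u"] xu assms by (simp add: dist_norm)
    have "r \<le> infdist (x + s *\<^sub>R u) G" if r: "r < s" for r
    proof -
      \<comment> \<open>By the Lipschitz property the distance at \<open>s\<close> is at least
        \<open>t - (s - t) = 2 * t - s\<close>. The second entry makes this at least
        \<open>r\<close>, the first keeps \<open>t\<close> positive.\<close>
      define t where "t = max (s / 2) ((r + s) / 2)"
      have t: "0 < t" "t < s" "r \<le> 2 * t - s" using r assms(4) by (auto simp: t_def max_def field_simps)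
      have "ereal t < reach G (x, u)" using le t(2) by (meson less_ereal.simps(1) less_le_trans)
      then have "infdist (x + t *\<^sub>R u) G = t" using reach_ray[OF assms(1-3) t(1)] by simp
      moreover have "dist (x + t *\<^sub>R u) (x + s *\<^sub>R u) = norm ((t - s) *\<^sub>R u)"
        by (simp add: dist_norm algebra_simps)
      ultimately show ?thesis
        using infdist_triangle[of "x + t *\<^sub>R u" G "x + s *\<^sub>R u"] t xu by simp
    qed
    then show "s \<le> infdist (x + s *\<^sub>R u) G" by (rule dense_le)
  qed
next
  have xu: "x \<in> G" "norm u = 1" using NorE[OF assms(1-3)] by metis+
  assume eq: "infdist (x + s *\<^sub>R u) G = s"
  show "ereal s \<le> reach G (x, u)"
  \<comment> \<open>The point at distance \<open>s\<close> may belong to the skeleton and is then no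
    witness in \<open>reach\<close>; every smaller positive radius is one.\<close>
  proof (rule dense_le_bounded[where x = 0])
    show "0 < ereal s" using assms by simp
    fix w assume w: "0 < w" "w < ereal s"
    obtain t where t: "w = ereal t" "0 < t" "t < s"
      using w by (cases w) (simp_all add: zero_ereal_def)
    show "w \<le> reach G (x, u)"
      unfolding t(1) using ray_proj[OF xu eq t(2,3)] t(2) by (intro reach_upper)
  qed
qed

lemma borel_infdist [measurable]: "(\<lambda>z. infdist z G) \<in> borel_measurable borel"
  by (intro borel_measurable_continuous_onI continuous_intros)

text \<open>Two distinct nearest points are at least \<open>1 / real (Suc n)\<close> apart for some
  \<open>n\<close>. For fixed \<open>n\<close> this is a closed condition, and projecting along the
  compact factor \<open>G \<times> G\<close> keeps it closed, so the skeleton is an F-sigma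
  set.\<close>

lemma borel_skel:
  fixes G :: "'a::euclidean_space set"
  assumes "compact G"
  shows "skel G \<in> sets borel"
proof -
  define D where "D n = {((x, y), z::'a). x \<in> G \<and> y \<in> G \<and> dist x y \<ge> 1 / real (Suc n) \<and>
                           dist z x = infdist z G \<and> dist z y = infdist z G}" for n
  have closedD: "closed (D n)" for n
  proof -
    have "D n = ((G \<times> G) \<times> UNIV) \<inter> {w. 1 / real (Suc n) \<le> dist (fst (fst w)) (snd (fst w))}
        \<inter> {w. dist (snd w) (fst (fst w)) = infdist (snd w) G}
        \<inter> {w. dist (snd w) (snd (fst w)) = infdist (snd w) G}"
      by (auto simp: D_def)
    moreover have "closed \<dots>"
      using assms by (intro closed_Int closed_Collect_le closed_Collect_eq closed_Times continuous_intros)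
        (auto simp: compact_imp_closed)
    ultimately show ?thesis by simp
  qed
  have "closed {z. \<exists>w. w \<in> G \<times> G \<and> (w, z) \<in> D n}" for n
    using closed_compact_projection[of "G \<times> G" "D n"] closedD[of n] assms by (simp add: compact_Times)
  moreover have "skel G = (\<Union>n. {z. \<exists>w. w \<in> G \<times> G \<and> (w, z) \<in> D n})"
  proof (intro set_eqI iffI)
    fix z assume "z \<in> skel G"
    then obtain x y where xy: "x \<in> G" "y \<in> G" "x \<noteq> y" "dist z x = infdist z G" "dist z y = infdist z G"
      by (auto simp: skel_def)
    obtain n where "1 / real (Suc n) < dist x y"
      using reals_Archimedean[of "dist x y"] xy(3) by (auto simp: inverse_eq_divide)
    then have "((x, y), z) \<in> D n" using xy by (simp add: D_def)
    with xy show "z \<in> (\<Union>n. {z. \<exists>w. w \<in> G \<times> G \<and> (w, z) \<in> D n})" by blast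
  next
    fix z assume "z \<in> (\<Union>n. {z. \<exists>w. w \<in> G \<times> G \<and> (w, z) \<in> D n})"
    then show "z \<in> skel G" by (fastforce simp: D_def skel_def)
  qed
  ultimately show ?thesis by auto
qed

text \<open>Off the skeleton, the nearest point lies in a closed set \<open>C\<close> exactly when
  the distances to \<open>G\<close> and to \<open>G \<inter> C\<close> agree, and distances are
  continuous.\<close>

lemma borel_proj:
  fixes G :: "'a::euclidean_space set"
  assumes "compact G" "G \<noteq> {}"
  shows "proj G \<in> measurable (restrict_space borel (- skel G)) borel"
proof -
  have cl: "closed G" using assms(1) by (rule compact_imp_closed)
  have sk: "skel G \<in> sets borel" using assms(1) by (rule borel_skel)
  have closed_preimage: "proj G -` C \<inter> - skel G \<in> sets borel" if C: "closed C" for C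
  proof (cases "G \<inter> C = {}")
    \<comment> \<open>\<open>infdist\<close> to the empty set is 0 by convention, so comparing
      distances makes sense only if \<open>G\<close> meets \<open>C\<close>.\<close>
    case True
    then have "proj G -` C \<inter> - skel G = {}" using proj_nearest(1)[OF cl assms(2)] by auto
    then show ?thesis by simp
  next
    case False
    have clC: "closed (G \<inter> C)" using cl C by (rule closed_Int)
    have "proj G z \<in> C \<longleftrightarrow> infdist z (G \<inter> C) = infdist z G" if z: "z \<notin> skel G" for z
    proof
      assume "proj G z \<in> C"
      then have "infdist z (G \<inter> C) \<le> infdist z G"
        using proj_nearest[OF cl assms(2) z] infdist_le[of "proj G z" "G \<inter> C" z] by auto
      moreover have "infdist z G \<le> infdist z (G \<inter> C)"
        using False by (intro infdist_mono) auto
      ultimately show "infdist z (G \<inter> C) = infdist z G" by simp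
    next
      assume eq: "infdist z (G \<inter> C) = infdist z G"
      obtain y where y: "y \<in> G \<inter> C" "infdist z (G \<inter> C) = dist z y"
        using infdist_attains_inf[OF clC False] by metis
      then have "proj G z = y" using eq z by (intro proj_eqI) auto
      then show "proj G z \<in> C" using y by simp
    qed
    then have "proj G -` C \<inter> - skel G = {z. infdist z (G \<inter> C) = infdist z G} - skel G" by auto
    also have "\<dots> \<in> sets borel"
      by (intro sets.Diff sk borel_closed closed_Collect_eq continuous_intros)
    finally show ?thesis .
  qed
  show ?thesis
  proof (rule borel_measurableI)
    fix S :: "'a set" assume "open S"
    then have "proj G -` (- S) \<inter> - skel G \<in> sets borel" by (intro closed_preimage) auto
    then have "(- skel G) - (proj G -` (- S) \<inter> - skel G) \<in> sets borel" using sk by auto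
    also have "(- skel G) - (proj G -` (- S) \<inter> - skel G) = proj G -` S \<inter> - skel G" by auto
    finally show "proj G -` S \<inter> space (restrict_space borel (- skel G)) \<in> sets (restrict_space borel (- skel G))"
      using sk by (simp add: sets_restrict_space_iff space_restrict_space)
  qed
qed

section \<open>The normal cylinder as a measure space\<close>

text \<open>If the integral is infinite, both sides are 0: the left through \<open>enn2real\<close>,
  the right by the convention for non-integrable functions.\<close>

lemma measure_density_eq_integral:
  fixes g :: "'b \<Rightarrow> real"
  assumes "g \<in> borel_measurable M" "X \<in> sets M" "\<And>x. x \<in> X \<Longrightarrow> 0 \<le> g x"
  shows "measure (density M (\<lambda>x. ennreal (g x))) X = (\<integral>x. indicator X x * g x \<partial>M)"
proof -
  have "measure (density M (\<lambda>x. ennreal (g x))) X = enn2real (\<integral>\<^sup>+x. ennreal (g x) * indicator X x \<partial>M)"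
    using assms by (simp add: measure_def emeasure_density)
  also have "(\<integral>\<^sup>+x. ennreal (g x) * indicator X x \<partial>M) = (\<integral>\<^sup>+x. ennreal (indicator X x * g x) \<partial>M)"
    by (intro nn_integral_cong) (simp split: split_indicator)
  also have "enn2real \<dots> = (\<integral>x. indicator X x * g x \<partial>M)"
    using assms by (intro integral_eq_nn_integral[symmetric]) (auto split: split_indicator)
  finally show ?thesis .
qed

text \<open>\<open>proj\<close> takes unspecified values on the skeleton. Replacing
  \<open>h (proj F z)\<close> there by 0 gives a Borel function and leaves the product unchanged,
  since \<open>A\<close> avoids the skeleton.\<close>

lemma borel_fun_proj:
  fixes F :: "'a::euclidean_space set" and h :: "'a \<Rightarrow> real"
  assumes "compact F" "F \<noteq> {}" "h \<in> borel_measurable borel" "A \<in> sets borel" "A \<inter> skel F = {}"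
  shows "(\<lambda>z. indicator A z * h (proj F z)) \<in> borel_measurable borel"
proof -
  have sk: "skel F \<in> sets borel" using assms(1) by (rule borel_skel)
  have "(\<lambda>z. h (proj F z)) \<in> borel_measurable (restrict_space borel (- skel F))"
    using borel_proj[OF assms(1,2)] assms(3) by (rule measurable_compose)
  then have "(\<lambda>z. if z \<notin> skel F then h (proj F z) else 0) \<in> borel_measurable borel"
    using sk by (subst measurable_If_restrict_space_iff)
      (auto simp: Compl_eq[symmetric] Collect_neg_eq[symmetric] Compl_eq_Diff_UNIV[symmetric])
  then have "(\<lambda>z. indicator A z * (if z \<notin> skel F then h (proj F z) else 0)) \<in> borel_measurable borel"
    using assms(4) by (intro borel_measurable_times) auto
  also have "(\<lambda>z. indicator A z * (if z \<notin> skel F then h (proj F z) else 0)) =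
      (\<lambda>z. indicator A z * h (proj F z))"
    using assms(5) by (auto simp: fun_eq_iff split: split_indicator)
  finally show ?thesis .
qed

text \<open>Inverts the magnification map: the only candidate preimage of \<open>(t, x, u)\<close>
  is \<open>x + (e * t) *\<^sub>R u\<close>. Membership becomes a condition along the ray, which
  serves both measurability and the Steiner formula.\<close>

lemma mem_magnify_iff:
  assumes "closed F" "F \<noteq> {}" "0 < e" "A \<inter> (F \<union> skel F) = {}"
  shows "(t, x, u) \<in> magnify F e A \<longleftrightarrow> (x, u) \<in> Nor F \<and> 0 < t \<and> x + (e * t) *\<^sub>R u \<in> A \<and>
    proj F (x + (e * t) *\<^sub>R u) = x"
proof
  assume "(t, x, u) \<in> magnify F e A"
  then obtain z where z: "t = infdist z F / e" "x = proj F z" "u = udir F z" "z \<in> A" "z \<notin> F" "z \<notin> skel F"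
    by (auto simp: magnify_def)
  have "x + (e * t) *\<^sub>R u = z"
    using udir_props(2)[OF assms(1,2) z(6,5)] z(1-3) assms(3) by simp
  moreover have "0 < t" using z(1) infdist_pos[OF assms(1,2) z(5)] assms(3) by simp
  moreover have "(x, u) \<in> Nor F" using z by (auto simp: Nor_def)
  ultimately show "(x, u) \<in> Nor F \<and> 0 < t \<and> x + (e * t) *\<^sub>R u \<in> A \<and> proj F (x + (e * t) *\<^sub>R u) = x"
    using z by simp
next
  assume a: "(x, u) \<in> Nor F \<and> 0 < t \<and> x + (e * t) *\<^sub>R u \<in> A \<and> proj F (x + (e * t) *\<^sub>R u) = x"
  let ?z = "x + (e * t) *\<^sub>R u"
  have u: "norm u = 1" using NorE[OF assms(1,2)] a by metis
  have z: "?z \<notin> skel F" "?z \<notin> F" using a assms(4) by auto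
  have i: "infdist ?z F = e * t"
    using a assms by (intro infdist_of_proj(1)[OF assms(1,2) u _ z(1)]) auto
  have "udir F ?z = (e * t) *\<^sub>R u /\<^sub>R (e * t)" unfolding udir_def i using a by simp
  moreover have "e * t \<noteq> 0" using a assms(3) by simp
  ultimately have "udir F ?z = u" by (simp del: inverse_mult_distrib mult_eq_0_iff)
  then show "(t, x, u) \<in> magnify F e A"
    unfolding magnify_def using a z i assms(3) by (auto intro!: exI[of _ ?z])
qed

lemma magnify_subset_cylinder:
  assumes "closed F" "F \<noteq> {}" "0 < e" "A \<subseteq> parallel_set F (e * T)"
  shows "magnify F e A \<subseteq> normal_cylinder_T F T"
  using assms by (auto simp: magnify_def normal_cylinder_T_def parallel_set_def Nor_def field_simps infdist_nonneg)

text \<open>\<open>N\<close> stands for Theta_{d-1}(F, .), which is nonnegative and so equals its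
  positive part. Finiteness on sublevel sets yields sigma-finiteness, hence Fubini on the normal
  cylinder.\<close>

locale normal_measure =
  fixes F :: "'a::euclidean_space set" and N :: "('a \<times> 'a) measure"
  assumes compact_F: "compact F" and F_ne: "F \<noteq> {}"
    and sets_N: "sets N = sets (restrict_space borel (Nor F))"
    and finite_sublevel: "\<And>c. c > 0 \<Longrightarrow> emeasure N (sublevel F c) < \<infinity>"
begin

lemma closed_F: "closed F"
  using compact_F by (rule compact_imp_closed)

lemma space_N: "space N = Nor F"
  using sets_eq_imp_space_eq[OF sets_N] by (simp add: space_restrict_space)

lemma measurable_fst_snd_N [measurable]:
  "fst \<in> borel_measurable N" "snd \<in> borel_measurable N"
proof -
  show "fst \<in> borel_measurable N"
    unfolding measurable_cong_sets[OF sets_N refl]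
    by (intro measurable_restrict_space1 borel_measurable_continuous_onI continuous_on_fst continuous_on_id)
  show "snd \<in> borel_measurable N"
    unfolding measurable_cong_sets[OF sets_N refl]
    by (intro measurable_restrict_space1 borel_measurable_continuous_onI continuous_on_snd continuous_on_id)
qed

lemma sets_sublevel:
  assumes "c > 0"
  shows "sublevel F c \<in> sets N"
proof -
  have "sublevel F c = {w \<in> space N. norm (fst w) \<le> c \<and> infdist (fst w + (1 / c) *\<^sub>R snd w) F = 1 / c}"
    using le_reach_iff[OF closed_F F_ne, of _ _ "1 / c"] assms
    by (auto simp: sublevel_def space_N)
  also have "\<dots> \<in> sets N" by measurable
  finally show ?thesis .
qed

text \<open>A normal pair comes from a point off \<open>F\<close>, whose distance to
  \<open>F\<close> is a positive lower bound for the reach.\<close>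

lemma Union_sublevel: "(\<Union>n. sublevel F (real (Suc n))) = Nor F"
proof (intro set_eqI iffI)
  fix w assume w: "w \<in> Nor F"
  obtain x u where xu: "w = (x, u)" by (cases w)
  obtain s where s: "s > 0" "infdist (x + s *\<^sub>R u) F = s"
    using NorE[OF closed_F F_ne] w xu by metis
  obtain n :: nat where n: "max (norm x) (1 / s) \<le> real n" using real_arch_simple by blast
  have "0 < real (Suc n)" by simp
  then have "1 / real (Suc n) \<le> s" using n s(1) by (simp add: field_simps)
  moreover have "ereal s \<le> reach F (x, u)" using le_reach_iff[OF closed_F F_ne] w xu s by simp
  ultimately have "ereal (1 / real (Suc n)) \<le> reach F (x, u)" by (meson ereal_less_eq(3) order_trans)
  then have "w \<in> sublevel F (real (Suc n))" using w xu n by (auto simp: sublevel_def)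
  then show "w \<in> (\<Union>n. sublevel F (real (Suc n)))" by blast
qed (auto simp: sublevel_def)

sublocale sigma_finite_measure N
proof
  let ?A = "range (\<lambda>n. sublevel F (real (Suc n)))"
  have "countable ?A \<and> ?A \<subseteq> sets N \<and> \<Union> ?A = space N \<and> (\<forall>a\<in>?A. emeasure N a \<noteq> \<infinity>)"
    using Union_sublevel finite_sublevel sets_sublevel by (auto simp: space_N less_top simp del: of_nat_Suc)
  then show "\<exists>A. countable A \<and> A \<subseteq> sets N \<and> \<Union> A = space N \<and> (\<forall>a\<in>A. emeasure N a \<noteq> \<infinity>)" by blast
qed

sublocale pair_sigma_finite lborel N ..

lemma sets_magnify:
  assumes "0 < e" "A \<in> sets borel" "A \<inter> (F \<union> skel F) = {}"
  shows "magnify F e A \<in> sets (lborel \<Otimes>\<^sub>M N)"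
proof -
  define ray where "ray w = fst (snd w) + (e * fst w) *\<^sub>R snd (snd w)" for w :: "real \<times> 'a \<times> 'a"
  have ray [measurable]: "ray \<in> borel_measurable (lborel \<Otimes>\<^sub>M N)"
    unfolding ray_def by measurable
  \<comment> \<open>A Borel map on the whole space that agrees with \<open>proj F\<close> on
    \<open>A\<close>, since \<open>A\<close> misses the skeleton.\<close>
  define q where "q z = (if z \<notin> skel F then proj F z else 0)" for z
  have sk: "skel F \<in> sets borel" using compact_F by (rule borel_skel)
  have [measurable]: "q \<in> borel_measurable borel"
    unfolding q_def using borel_proj[OF compact_F F_ne] sk
    by (subst measurable_If_restrict_space_iff)
      (auto simp: Compl_eq[symmetric] Collect_neg_eq[symmetric] Compl_eq_Diff_UNIV[symmetric])
  have "magnify F e A =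
      {w \<in> space (lborel \<Otimes>\<^sub>M N). 0 < fst w \<and> ray w \<in> A \<and> q (ray w) = fst (snd w)}"
    using mem_magnify_iff[OF closed_F F_ne assms(1,3)] assms(3)
    by (auto simp: space_pair_measure space_N ray_def q_def)
  also have "\<dots> \<in> sets (lborel \<Otimes>\<^sub>M N)" using assms(2) by measurable
  finally show ?thesis .
qed

section \<open>Integrals of functions of the base point over the normal cylinder\<close>

context
  fixes h :: "'a \<Rightarrow> real"
  assumes h_meas [measurable]: "h \<in> borel_measurable borel"
    and h_int: "integrable N (\<lambda>xu. h (fst xu))"
begin

text \<open>Supplies the integrable majorant for all measurable subsets of
  \<open>normal_cylinder_T F T\<close>.\<close>

lemma integrable_cylinder:
  fixes T :: real
  shows "integrable (lborel \<Otimes>\<^sub>M N) (\<lambda>w. indicator {-T..T} (fst w) * h (fst (snd w)))"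
proof (rule Fubini_integrable)
  have "(\<lambda>t. indicator {-T..T} t * (\<integral>xu. \<bar>h (fst xu)\<bar> \<partial>N)) =
    (\<lambda>t. \<integral>xu. norm (indicator {-T..T} (fst (t, xu)) * h (fst (snd (t, xu)))) \<partial>N)"
    by (simp add: abs_mult)
  moreover have "integrable lborel (\<lambda>t. indicator {-T..T} t * (\<integral>xu. \<bar>h (fst xu)\<bar> \<partial>N))"
    by (intro integrable_mult_left integrable_real_indicator)
      (auto simp: emeasure_lborel_Icc_eq)
  ultimately show "integrable lborel (\<lambda>t. \<integral>xu. norm (indicator {-T..T} (fst (t, xu)) * h (fst (snd (t, xu)))) \<partial>N)"
    by simp
  show "AE t in lborel. integrable N (\<lambda>xu. indicator {-T..T} (fst (t, xu)) * h (fst (snd (t, xu))))"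
    using h_int by simp
qed measurable

lemma integrable_subset_cylinder:
  assumes [measurable]: "X \<in> sets (lborel \<Otimes>\<^sub>M N)" and X: "X \<subseteq> normal_cylinder_T F T"
  shows "integrable (lborel \<Otimes>\<^sub>M N) (\<lambda>w. indicator X w * h (fst (snd w)))"
proof (rule Bochner_Integration.integrable_bound[OF integrable_cylinder[of T]])
  show "AE w in lborel \<Otimes>\<^sub>M N. norm (indicator X w * h (fst (snd w)))
      \<le> norm (indicator {-T..T} (fst w) * h (fst (snd w)))"
    using X by (intro AE_I2) (auto simp: normal_cylinder_T_def split: split_indicator)
qed measurable

text \<open>The integrands differ only on the symmetric difference, and there by at most
  \<open>C\<close> because base points lie in \<open>F\<close>. This converts convergence of sets in
  measure into convergence of integrals.\<close>

lemma integral_indicator_diff_le: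
  assumes X: "X \<in> sets (lborel \<Otimes>\<^sub>M N)" "X \<subseteq> normal_cylinder_T F T"
    and Y: "Y \<in> sets (lborel \<Otimes>\<^sub>M N)" "Y \<subseteq> normal_cylinder_T F T"
    and C: "\<And>x. x \<in> F \<Longrightarrow> \<bar>h x\<bar> \<le> C"
    and fin: "emeasure (lborel \<Otimes>\<^sub>M N) (X \<union> Y - X \<inter> Y) < \<infinity>"
  shows "\<bar>(\<integral>w. indicator X w * h (fst (snd w)) \<partial>(lborel \<Otimes>\<^sub>M N)) -
           (\<integral>w. indicator Y w * h (fst (snd w)) \<partial>(lborel \<Otimes>\<^sub>M N))\<bar>
         \<le> C * measure (lborel \<Otimes>\<^sub>M N) (X \<union> Y - X \<inter> Y)"
proof -
  let ?M = "(lborel :: real measure) \<Otimes>\<^sub>M N"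
  have [measurable]: "X \<in> sets ?M" "Y \<in> sets ?M" by fact+
  have iX: "integrable ?M (\<lambda>w. indicator X w * h (fst (snd w)))"
    and iY: "integrable ?M (\<lambda>w. indicator Y w * h (fst (snd w)))"
    using integrable_subset_cylinder X Y by blast+
  have "\<bar>(\<integral>w. indicator X w * h (fst (snd w)) \<partial>?M) - (\<integral>w. indicator Y w * h (fst (snd w)) \<partial>?M)\<bar>
     = \<bar>\<integral>w. indicator X w * h (fst (snd w)) - indicator Y w * h (fst (snd w)) \<partial>?M\<bar>"
    using iX iY by simp
  also have "\<dots> \<le> (\<integral>w. \<bar>indicator X w * h (fst (snd w)) - indicator Y w * h (fst (snd w))\<bar> \<partial>?M)"
    using integral_norm_bound[of ?M "\<lambda>w. indicator X w * h (fst (snd w)) - indicator Y w * h (fst (snd w))"] by simp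
  also have "\<dots> \<le> (\<integral>w. C * indicator (X \<union> Y - X \<inter> Y) w \<partial>?M)"
  proof (rule integral_mono)
    show "integrable ?M (\<lambda>w. C * indicator (X \<union> Y - X \<inter> Y) w)"
      using fin by (intro integrable_mult_right integrable_real_indicator) measurable
    fix w assume "w \<in> space ?M"
    then have "fst (snd w) \<in> F"
      using NorE[OF closed_F F_ne] by (auto simp: space_pair_measure space_N)
    then show "\<bar>indicator X w * h (fst (snd w)) - indicator Y w * h (fst (snd w))\<bar> \<le> C * indicator (X \<union> Y - X \<inter> Y) w"
      using C by (auto split: split_indicator)
  qed (use iX iY in auto)
  also have "\<dots> = C * measure ?M (X \<union> Y - X \<inter> Y)"
  proof -
    have "X \<union> Y - X \<inter> Y \<subseteq> space ?M"
      using sets.sets_into_space[OF X(1)] sets.sets_into_space[OF Y(1)] by blast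
    then show ?thesis by (simp add: Int_absorb2)
  qed
  finally show ?thesis .
qed

text \<open>Multiplication by \<open>e\<close> maps the section of the magnified set over
  \<open>(x, u)\<close> onto the part of the ray in \<open>A\<close>, up to one point; the Jacobian
  of this substitution is the factor \<open>e\<close>. The weight \<open>t ^ (j - 1)\<close> is 1
  for \<open>j = 1\<close>.\<close>

lemma steiner_leading_term:
  assumes e: "0 < e" and A: "A \<in> sets borel" "A \<inter> (F \<union> skel F) = {}" "A \<subseteq> parallel_set F (e * T)"
  shows "(\<integral>xu. (LINT t : {t. 0 < t \<and> ereal t < reach F xu} | lborel.
            indicator A (fst xu + t *\<^sub>R snd xu) * h (proj F (fst xu + t *\<^sub>R snd xu))) \<partial>N)
       = e * (\<integral>w. indicator (magnify F e A) w * h (fst (snd w)) \<partial>(lborel \<Otimes>\<^sub>M N))"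
proof -
  let ?X = "magnify F e A"
  have X [measurable]: "?X \<in> sets (lborel \<Otimes>\<^sub>M N)" using sets_magnify e A by simp
  define g where "g z = indicator A z * h (proj F z)" for z
  have g [measurable]: "g \<in> borel_measurable borel"
    unfolding g_def using A by (intro borel_fun_proj compact_F F_ne h_meas) auto
  have inner: "(LINT t : {t. 0 < t \<and> ereal t < reach F xu} | lborel. g (fst xu + t *\<^sub>R snd xu))
      = e * (\<integral>t. indicator ?X (t, xu) * h (fst xu) \<partial>lborel)" if xu: "xu \<in> space N" for xu
  proof -
    obtain x u where [simp]: "xu = (x, u)" by (cases xu)
    have Nor: "(x, u) \<in> Nor F" using xu by (simp add: space_N)
    let ?S = "{t. 0 < t \<and> ereal t < reach F (x, u)}"
    have "(LINT t : ?S | lborel. g (x + t *\<^sub>R u))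
       = e * (\<integral>t. indicator ?S (e * t) * g (x + (e * t) *\<^sub>R u) \<partial>lborel)"
      unfolding set_lebesgue_integral_def
      using lborel_integral_real_affine[of e "\<lambda>t. indicator ?S t *\<^sub>R g (x + t *\<^sub>R u)" 0] e by simp
    also have "(\<integral>t. indicator ?S (e * t) * g (x + (e * t) *\<^sub>R u) \<partial>lborel)
       = (\<integral>t. indicator ?X (t, x, u) * h x \<partial>lborel)"
    proof (rule integral_cong_AE)
      \<comment> \<open>at \<open>e * t = reach\<close> the nearest point may still be unique, although the Steiner formula integrates
        over the open interval only\<close>
      have "AE t in lborel. t \<noteq> real_of_ereal (reach F (x, u)) / e" by (rule AE_lborel_singleton)
      then show "AE t in lborel. indicator ?S (e * t) * g (x + (e * t) *\<^sub>R u) = indicator ?X (t, x, u) * h x"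
      proof (rule AE_mp, intro AE_I2 impI)
        fix t assume t: "t \<noteq> real_of_ereal (reach F (x, u)) / e"
        show "indicator ?S (e * t) * g (x + (e * t) *\<^sub>R u) = indicator ?X (t, x, u) * h x"
        proof (cases "e * t \<in> ?S")
          case True
          then show ?thesis
            using reach_ray[OF closed_F F_ne Nor, of "e * t"] Nor e A
            by (simp add: g_def mem_magnify_iff[OF closed_F F_ne] indicator_def zero_less_mult_iff)
        next
          case False
          have "(t, x, u) \<notin> ?X"
          proof
            assume "(t, x, u) \<in> ?X"
            then have p: "0 < t" "x + (e * t) *\<^sub>R u \<in> A" "proj F (x + (e * t) *\<^sub>R u) = x"
              using mem_magnify_iff[OF closed_F F_ne e A(2)] by auto
            then have "x + (e * t) *\<^sub>R u \<notin> skel F" using A(2) by auto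
            then have "ereal (e * t) \<le> reach F (x, u)" using reach_upper p e by (metis mult_pos_pos)
            \<comment> \<open>For infinite reach \<open>real_of_ereal\<close> returns 0, but then
              equality with the finite \<open>ereal (e * t)\<close> is impossible.\<close>
            moreover have "ereal (e * t) \<noteq> reach F (x, u)"
              using t e by (metis nonzero_mult_div_cancel_left order_less_irrefl real_of_ereal.simps(1))
            ultimately show False using False p e by (simp add: less_le)
          qed
          then show ?thesis using False by simp
        qed
      qed
      show "(\<lambda>t. indicator ?X (t, x, u) * h x) \<in> borel_measurable lborel"
        using measurable_compose[OF measurable_Pair2'[of "(x, u)" N lborel] borel_measurable_indicator[OF X]] xu
        by (intro borel_measurable_times) auto
      show "(\<lambda>t. indicator ?S (e * t) * g (x + (e * t) *\<^sub>R u)) \<in> borel_measurable lborel"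
        by measurable
    qed
    finally show ?thesis by simp
  qed
  have "(\<integral>xu. (LINT t : {t. 0 < t \<and> ereal t < reach F xu} | lborel. g (fst xu + t *\<^sub>R snd xu)) \<partial>N)
     = (\<integral>xu. e * (\<integral>t. indicator ?X (t, xu) * h (fst xu) \<partial>lborel) \<partial>N)"
    using inner by (intro Bochner_Integration.integral_cong) auto
  also have "\<dots> = e * (\<integral>xu. \<integral>t. indicator ?X (t, xu) * h (fst xu) \<partial>lborel \<partial>N)" by simp
  also have "(\<integral>xu. \<integral>t. indicator ?X (t, xu) * h (fst xu) \<partial>lborel \<partial>N)
     = (\<integral>w. indicator ?X w * h (fst (snd w)) \<partial>(lborel \<Otimes>\<^sub>M N))"
  proof -
    have eq: "(\<lambda>(t, xu). indicator ?X (t, xu) * h (fst xu)) = (\<lambda>w. indicator ?X w * h (fst (snd w)))"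
      by auto
    have "integrable (lborel \<Otimes>\<^sub>M N) (\<lambda>w. indicator ?X w * h (fst (snd w)))"
      using X magnify_subset_cylinder[OF closed_F F_ne e A(3)] by (rule integrable_subset_cylinder)
    then show ?thesis
      unfolding eq[symmetric] by (rule integral_snd)
  qed
  finally show ?thesis unfolding g_def .
qed

end

end

section \<open>The Steiner formula for small parallel sets\<close>

text \<open>On a ray below the reach the distance to \<open>F\<close> is \<open>t\<close>, so only
  \<open>t \<le> R\<close> meets \<open>A\<close>, and there
  \<open>t ^ (j - 1) \<le> R ^ (j - 1)\<close>. Integrating over an interval of length
  \<open>R\<close> contributes the remaining factor.\<close>

lemma steiner_term_bound:
  fixes F :: "'a::euclidean_space set" and h :: "'a \<Rightarrow> real"
  assumes "closed F" "F \<noteq> {}" "space P = Nor F"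
    and h_int: "integrable P (\<lambda>xu. h (fst xu))" and h_nonneg: "\<And>x. x \<in> F \<Longrightarrow> 0 \<le> h x"
    and R: "0 \<le> R" "A \<subseteq> parallel_set F R" and j: "1 \<le> j"
  shows "\<bar>\<integral>xu. (LINT t : {t. 0 < t \<and> ereal t < reach F xu} | lborel.
           indicator A (fst xu + t *\<^sub>R snd xu) * h (proj F (fst xu + t *\<^sub>R snd xu)) * t ^ (j - 1)) \<partial>P\<bar>
         \<le> R ^ j * (\<integral>xu. h (fst xu) \<partial>P)"
proof -
  define \<phi> where "\<phi> xu t = indicator {t. 0 < t \<and> ereal t < reach F xu} t *
    (indicator A (fst xu + t *\<^sub>R snd xu) * h (proj F (fst xu + t *\<^sub>R snd xu)) * t ^ (j - 1))" for xu t
  have inner: "\<bar>\<integral>t. \<phi> xu t \<partial>lborel\<bar> \<le> R ^ j * h (fst xu)" if xu: "xu \<in> space P" for xu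
  proof -
    obtain x u where [simp]: "xu = (x, u)" by (cases xu)
    have Nor: "(x, u) \<in> Nor F" using xu assms(3) by simp
    have hx: "0 \<le> h x" using h_nonneg NorE[OF assms(1,2) Nor] by metis
    have "\<bar>\<integral>t. \<phi> xu t \<partial>lborel\<bar> \<le> (\<integral>t. \<bar>\<phi> xu t\<bar> \<partial>lborel)"
      using integral_norm_bound[of lborel "\<phi> xu"] by simp
    also have "\<dots> \<le> (\<integral>t. indicator {0..R} t * (h x * R ^ (j - 1)) \<partial>lborel)"
    proof (rule integral_mono')
      show "integrable lborel (\<lambda>t. indicator {0..R} t * (h x * R ^ (j - 1)))"
        by (intro integrable_mult_left integrable_real_indicator) (auto simp: emeasure_lborel_Icc_eq)
      fix t
      show "0 \<le> indicator {0..R} t * (h x * R ^ (j - 1))" using hx R by simp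
      show "\<bar>\<phi> xu t\<bar> \<le> indicator {0..R} t * (h x * R ^ (j - 1))"
      proof (cases "0 < t \<and> ereal t < reach F (x, u) \<and> x + t *\<^sub>R u \<in> A")
        case True
        then have p: "proj F (x + t *\<^sub>R u) = x" "infdist (x + t *\<^sub>R u) F = t"
          using reach_ray[OF assms(1,2) Nor] by auto
        have t: "0 < t" "t \<le> R" using p True R by (auto simp: parallel_set_def)
        then have "t ^ (j - 1) \<le> R ^ (j - 1)" by (intro power_mono) auto
        then show ?thesis using True p t hx by (simp add: \<phi>_def abs_mult mult_left_mono)
      next
        case False
        then have "\<phi> xu t = 0" by (auto simp: \<phi>_def indicator_def)
        then show ?thesis using hx R by simp
      qed
    qed
    also have "\<dots> = R ^ j * h x" using R j by (simp add: power_eq_if)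
    finally show ?thesis by simp
  qed
  have "\<bar>\<integral>xu. (\<integral>t. \<phi> xu t \<partial>lborel) \<partial>P\<bar> \<le> (\<integral>xu. \<bar>\<integral>t. \<phi> xu t \<partial>lborel\<bar> \<partial>P)"
    using integral_norm_bound[of P "\<lambda>xu. \<integral>t. \<phi> xu t \<partial>lborel"] by simp
  \<comment> \<open>A non-integrable left-hand side has integral 0 by convention, so
    \<open>integral_mono'\<close> asks only for an integrable nonnegative majorant.\<close>
  also have "\<dots> \<le> (\<integral>xu. R ^ j * h (fst xu) \<partial>P)"
    using h_int inner by (intro integral_mono') (auto intro: order_trans[OF abs_ge_zero])
  finally show ?thesis by (simp add: \<phi>_def set_lebesgue_integral_def)
qed

lemma support_measures_space:
  assumes "support_measures F Thp Thn" "i < DIM('a)"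
  shows "space (Thp i) = Nor F" "space (Thn i) = Nor (F :: 'a::euclidean_space set)"
  using assms sets_eq_imp_space_eq[of "Thp i" "restrict_space borel (Nor F)"]
    sets_eq_imp_space_eq[of "Thn i" "restrict_space borel (Nor F)"]
  by (auto simp: support_measures_def space_restrict_space)

lemma steiner_formula:
  fixes F :: "'a::euclidean_space set" and g :: "'a \<Rightarrow> real"
  assumes "support_measures F Thp Thn" "g \<in> borel_measurable borel" "bounded (range g)" "bounded {z. g z \<noteq> 0}"
  shows "(\<integral> z. indicator (- F) z * g z \<partial>lebesgue) =
        (\<Sum>j = 1..DIM('a). real (DIM('a) - 1 choose (j - 1)) *
            ((\<integral> xu. (LINT t : {t. 0 < t \<and> ereal t < reach F xu} | lborel.
                        g (fst xu + t *\<^sub>R snd xu) * t ^ (j - 1)) \<partial>Thp (DIM('a) - j)) -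
             (\<integral> xu. (LINT t : {t. 0 < t \<and> ereal t < reach F xu} | lborel.
                        g (fst xu + t *\<^sub>R snd xu) * t ^ (j - 1)) \<partial>Thn (DIM('a) - j))))"
  using assms unfolding support_measures_def by blast

lemma null_skel:
  fixes F :: "'a::euclidean_space set"
  assumes sm: "support_measures F Thp Thn" and F: "compact F" "F \<noteq> {}"
  shows "skel F - F \<in> null_sets lborel"
proof -
  have cl: "closed F" using F(1) by (rule compact_imp_closed)
  have sk: "skel F \<in> sets borel" using F(1) by (rule borel_skel)
  \<comment> \<open>Truncation to balls supplies the bounded support demanded by
    \<open>steiner_formula\<close>, which sees only the complement of \<open>F\<close>.\<close>
  have "(skel F - F) \<inter> cball 0 (real n) \<in> null_sets lborel" for n
  proof -
    let ?S = "skel F \<inter> cball 0 (real n)"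
    let ?S' = "(skel F - F) \<inter> cball 0 (real n)"
    define g where "g = (indicator ?S :: 'a \<Rightarrow> real)"
    have S': "?S' \<in> sets borel" by (intro sets.Int sets.Diff sk borel_closed cl closed_cball)
    have zero: "(\<integral>xu. (LINT t : {t. 0 < t \<and> ereal t < reach F xu} | lborel.
        g (fst xu + t *\<^sub>R snd xu) * t ^ k) \<partial>P) = 0" if P: "space P = Nor F" for P k
    proof -
      have "(LINT t : {t. 0 < t \<and> ereal t < reach F xu} | lborel. g (fst xu + t *\<^sub>R snd xu) * t ^ k) = 0"
        if "xu \<in> space P" for xu
        using reach_ray(1)[OF cl F(2), of "fst xu" "snd xu"] P that unfolding set_lebesgue_integral_def
        by (intro integral_eq_zero_AE AE_I2) (auto simp: g_def split: split_indicator)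
      then show ?thesis by (intro integral_eq_zero_AE AE_I2) auto
    qed
    have "(\<integral>z. indicator (- F) z * g z \<partial>lebesgue) = 0"
    proof (subst steiner_formula[OF sm])
      show "g \<in> borel_measurable borel" unfolding g_def using sk by (intro borel_measurable_indicator) auto
      show "bounded (range g)" by (rule boundedI[of _ 1]) (auto simp: g_def indicator_def)
      show "bounded {z. g z \<noteq> 0}"
        by (rule bounded_subset[of "cball 0 (real n)"]) (auto simp: g_def indicator_def)
    qed (intro sum.neutral ballI, simp add: zero support_measures_space[OF sm])
    also have "(\<lambda>z. indicator (- F) z * g z) = indicator ?S'"
      by (auto simp: g_def indicator_def fun_eq_iff)
    finally have "measure lborel ?S' = 0" using S' by simp
    \<comment> \<open>A vanishing \<open>measure\<close> could also stem from infinite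
      \<open>emeasure\<close>; boundedness excludes this.\<close>
    moreover have "emeasure lborel ?S' < \<infinity>"
      by (intro emeasure_bounded_finite) (rule bounded_subset[of "cball 0 (real n)"], auto)
    ultimately show ?thesis using S' by (auto simp: emeasure_eq_ennreal_measure null_sets_def)
  qed
  then have "(\<Union>n. (skel F - F) \<inter> cball 0 (real n)) \<in> null_sets lborel"
    by (rule null_sets_UN)
  also have "(\<Union>n. (skel F - F) \<inter> cball 0 (real n)) = skel F - F"
    by (auto simp: real_arch_simple)
  finally show ?thesis .
qed

section \<open>Passing between extended and real integrals\<close>

lemma enn2real_divide_ennreal:
  assumes "0 < c"
  shows "enn2real (a / ennreal c) = enn2real a / c"
proof (cases a)
  case (real r)
  then show ?thesis using assms by (simp add: divide_ennreal)
next
  case top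
  then show ?thesis using assms by (simp add: ennreal_top_divide)
qed

text \<open>Integrability passes from \<open>\<gamma>\<close> to \<open>\<phi>\<close> through the
  finite L1 distance. This serves the density \<open>f\<close>, which is controlled only by its
  closeness to \<open>fbar\<close> near \<open>F\<close>.\<close>

lemma abs_integral_diff_le_enn2real:
  fixes \<phi> \<gamma> :: "'b \<Rightarrow> real"
  assumes "\<phi> \<in> borel_measurable M" "integrable M \<gamma>"
    and le: "(\<integral>\<^sup>+z. ennreal \<bar>\<phi> z - \<gamma> z\<bar> \<partial>M) \<le> R" and R: "R < \<infinity>"
  shows "\<bar>(\<integral>z. \<phi> z \<partial>M) - (\<integral>z. \<gamma> z \<partial>M)\<bar> \<le> enn2real R"
proof -
  have int: "integrable M (\<lambda>z. \<phi> z - \<gamma> z)"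
    using assms le_less_trans[OF le R] by (intro integrableI_bounded) auto
  then have "integrable M (\<lambda>z. (\<phi> z - \<gamma> z) + \<gamma> z)" using assms(2) by (rule Bochner_Integration.integrable_add)
  then have "integrable M \<phi>" by simp
  then have "(\<integral>z. \<phi> z \<partial>M) - (\<integral>z. \<gamma> z \<partial>M) = (\<integral>z. \<phi> z - \<gamma> z \<partial>M)" using assms(2) by simp
  moreover have "ennreal \<bar>\<integral>z. \<phi> z - \<gamma> z \<partial>M\<bar> \<le> R"
    using integral_norm_bound_ennreal[OF int] le by simp
  ultimately show ?thesis using R by (metis abs_ge_zero enn2real_ennreal enn2real_mono infinity_ennreal_def)
qed

theorem theorem6:
  fixes F :: "'a::euclidean_space set"
    and Thp Thn :: "nat \<Rightarrow> ('a \<times> 'a) measure"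
    and f fbar :: "'a \<Rightarrow> real"
    and T :: real
    and Fam :: "real \<Rightarrow> 'a set"
    and B :: "(real \<times> 'a \<times> 'a) set"
  assumes bs: "boundary_set F"
    and sm: "support_measures F Thp Thn"
    and f_meas: "f \<in> borel_measurable lebesgue" and f_nonneg: "\<And>z. f z \<ge> 0"
    and fbar_meas: "fbar \<in> borel_measurable borel"
    and fbar_nonneg: "\<And>x. x \<in> F \<Longrightarrow> fbar x \<ge> 0"
    and fbar_bdd: "bounded (fbar ` F)"
    and approx: "((\<lambda>e. (\<integral>\<^sup>+ z. ennreal (indicator {z. infdist z F \<le> e} z * \<bar>f z - fbar (proj F z)\<bar>) \<partial>lebesgue)
                      / ennreal e) \<longlongrightarrow> 0) (at_right 0)"
    and fbar_int: "\<And>i. i < DIM('a) \<Longrightarrow>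
                     integrable (Thp i) (\<lambda>xu. fbar (fst xu)) \<and> integrable (Thn i) (\<lambda>xu. fbar (fst xu))"
    and T_pos: "T > 0"
    and Fam_borel: "\<And>e. e \<in> {0..1} \<Longrightarrow> Fam e \<in> sets borel"
    and Fam0: "Fam 0 \<subseteq> F"
    and Fam_sub: "\<And>e. e \<in> {0..1} \<Longrightarrow> Fam e \<subseteq> parallel_set F (e * T)"
    and diff: "set_differentiable F Thp Fam B"
    and B_sub: "B \<subseteq> normal_cylinder_T F T"
  shows "((\<lambda>e. (measure (density lebesgue f) (Fam e) - measure (density lebesgue f) (Fam 0)) / e)
           \<longlongrightarrow> measure (density (lborel \<Otimes>\<^sub>M Thp (DIM('a) - 1)) (\<lambda>(s, x, u). ennreal (fbar x))) B)
         (at_right 0)"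
proof -

  \<comment> \<open>Null sets and the normal measure\<close>
  let ?d = "DIM('a)"
  define N where "N = Thp (?d - 1)"
  define M where "M = (lborel :: real measure) \<Otimes>\<^sub>M N"
  have d: "?d \<ge> 1" using DIM_positive[where 'a='a] by linarith
  have F: "compact F" "F \<noteq> {}" and F_null: "F \<in> null_sets lborel"
    using bs by (auto simp: boundary_set_def null_sets_def compact_imp_closed)
  have cl: "closed F" using F(1) by (rule compact_imp_closed)
  have sk: "skel F \<in> sets borel" using F(1) by (rule borel_skel)
  have sk_null: "F \<union> skel F \<in> null_sets lborel"
    using null_sets.Un[OF F_null null_skel[OF sm F]] by (simp add: Un_Diff_cancel)
  then have AE_K: "AE z in lebesgue. z \<notin> F \<union> skel F"
    by (intro AE_not_in) (simp add: null_sets_completionI)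
  interpret normal_measure F N
    by unfold_locales (use F sm d in \<open>auto simp: N_def support_measures_def\<close>)
  have h_int: "integrable N (\<lambda>xu. fbar (fst xu))" using fbar_int d by (simp add: N_def)
  obtain C where C: "\<And>x. x \<in> F \<Longrightarrow> \<bar>fbar x\<bar> \<le> C"
    using fbar_bdd by (auto simp: bounded_iff)
  have Fam_bdd: "bounded (Fam e)" if "e \<in> {0..1}" for e
    using diff that by (auto simp: set_differentiable_def)
  have B: "B \<in> sets M" using diff by (auto simp: set_differentiable_def M_def N_def)

  \<comment> \<open>Points of \<open>F\<close> have no normal direction and skeleton points no
    unique nearest point. Removing this null set changes neither the measure of \<open>Fam e\<close>
    nor its magnification.\<close>
  define A where "A e = Fam e - (F \<union> skel F)" for e
  have A_borel: "A e \<in> sets borel" if "e \<in> {0..1}" for e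
    unfolding A_def by (intro sets.Diff sets.Un Fam_borel that sk borel_closed cl)
  have A_disj: "A e \<inter> (F \<union> skel F) = {}" for e by (auto simp: A_def)
  have A_par: "A e \<subseteq> parallel_set F (e * T)" if "e \<in> {0..1}" for e
    using Fam_sub[OF that] by (auto simp: A_def)
  have mag_A: "magnify F e (A e) = magnify F e (Fam e)" for e
    by (auto simp: magnify_def A_def)

  \<comment> \<open>The limit measure and convergence of the leading term\<close>
  define Q where "Q X = (\<integral>w. indicator X w * fbar (fst (snd w)) \<partial>M)" for X
  have Q_B: "measure (density (lborel \<Otimes>\<^sub>M Thp (?d - 1)) (\<lambda>(s, x, u). ennreal (fbar x))) B = Q B"
  proof -
    have "(\<lambda>(s, x, u). ennreal (fbar x)) = (\<lambda>w :: real \<times> 'a \<times> 'a. ennreal (fbar (fst (snd w))))"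
      by auto
    moreover have "measure (density M (\<lambda>w. ennreal (fbar (fst (snd w))))) B = Q B"
      unfolding Q_def
    proof (rule measure_density_eq_integral)
      show "(\<lambda>w. fbar (fst (snd w))) \<in> borel_measurable M"
        unfolding M_def using fbar_meas by measurable
      fix w assume "w \<in> B"
      then have "snd w \<in> Nor F" using B_sub by (auto simp: normal_cylinder_T_def)
      then show "0 \<le> fbar (fst (snd w))"
        using NorE[OF cl F(2)] fbar_nonneg by (metis prod.collapse)
    qed (rule B)
    ultimately show ?thesis by (simp add: M_def N_def)
  qed

  define D where "D e = magnify F e (Fam e) \<union> B - magnify F e (Fam e) \<inter> B" for e
  have D_lim: "((\<lambda>e. emeasure M (D e)) \<longlongrightarrow> 0) (at_right 0)"
    using diff by (auto simp: set_differentiable_def M_def N_def D_def)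
  have in01: "\<forall>\<^sub>F e in at_right 0. e \<in> {0<..<1::real}"
    by (rule eventually_at_right_real) simp
  have Q_lim: "((\<lambda>e. Q (magnify F e (Fam e))) \<longlongrightarrow> Q B) (at_right 0)"
  proof -
    have "((\<lambda>e. C * measure M (D e)) \<longlongrightarrow> C * 0) (at_right 0)"
      unfolding measure_def using D_lim by (intro tendsto_intros) auto
    then have lim: "((\<lambda>e. C * measure M (D e)) \<longlongrightarrow> 0) (at_right 0)" by simp
    \<comment> \<open>\<open>measure\<close> is 0 on sets of infinite \<open>emeasure\<close>, so
      the bound by \<open>C * measure M (D e)\<close> becomes available only once
      \<open>emeasure M (D e)\<close> is finite.\<close>
    have "\<forall>\<^sub>F e in at_right 0. emeasure M (D e) < \<infinity>"
      using order_tendstoD(2)[OF D_lim] by simp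
    then have "\<forall>\<^sub>F e in at_right 0. norm (Q (magnify F e (Fam e)) - Q B) \<le> C * measure M (D e)"
      using in01
    proof eventually_elim
      case (elim e)
      then have e': "0 < e" "e \<in> {0..1}" by auto
      have X: "magnify F e (Fam e) \<in> sets M" "magnify F e (Fam e) \<subseteq> normal_cylinder_T F T"
        using sets_magnify[OF e'(1) A_borel[OF e'(2)] A_disj]
          magnify_subset_cylinder[OF cl F(2) e'(1) A_par[OF e'(2)]]
        by (auto simp: mag_A M_def)
      show ?case
        using integral_indicator_diff_le[OF fbar_meas h_int X[unfolded M_def] B[unfolded M_def] B_sub C] elim
        by (simp add: Q_def M_def D_def)
    qed
    from Lim_null_comparison[OF this lim] show ?thesis by (simp add: LIM_zero_iff)
  qed

  \<comment> \<open>Steiner expansion of the integral over \<open>Fam e\<close>\<close>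
  define g where "g e z = indicator (A e) z * fbar (proj F z)" for e z
  have g_borel: "g e \<in> borel_measurable borel" if "e \<in> {0..1}" for e
    unfolding g_def using A_disj by (intro borel_fun_proj F fbar_meas A_borel that) auto
  have g_le: "\<bar>g e z\<bar> \<le> C" for e z
  proof (cases "z \<in> A e")
    case True
    then show ?thesis using C proj_nearest(1)[OF cl F(2), of z] A_disj by (auto simp: g_def)
  next
    case False
    moreover have "0 \<le> C" using C F(2) by (meson abs_ge_zero ex_in_conv order_trans)
    ultimately show ?thesis by (simp add: g_def)
  qed
  have g_supp: "g e z \<noteq> 0 \<Longrightarrow> z \<in> Fam e" for e z
    by (auto simp: g_def A_def split: split_indicator_asm)
  define I where "I P j e = (\<integral>xu. (LINT t : {t. 0 < t \<and> ereal t < reach F xu} | lborel.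
      g e (fst xu + t *\<^sub>R snd xu) * t ^ (j - 1)) \<partial>P)" for P j e
  define summand where "summand j e = real (?d - 1 choose (j - 1)) * (I (Thp (?d - j)) j e - I (Thn (?d - j)) j e)" for j e

  have steiner: "(\<integral>z. g e z \<partial>lebesgue) = e * Q (magnify F e (Fam e)) + (\<Sum>j = 2..?d. summand j e)"
    if e: "e \<in> {0<..<1}" for e
  proof -
    have e': "e \<in> {0..1}" "0 < e" using e by auto
    have "(\<integral>z. g e z \<partial>lebesgue) = (\<integral>z. indicator (- F) z * g e z \<partial>lebesgue)"
      by (intro Bochner_Integration.integral_cong) (auto simp: g_def A_def split: split_indicator)
    also have "\<dots> = (\<Sum>j = 1..?d. summand j e)"
      unfolding summand_def I_def
    proof (rule steiner_formula[OF sm g_borel[OF e'(1)]])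
      show "bounded (range (g e))" using g_le by (auto intro: boundedI[of _ C])
      show "bounded {z. g e z \<noteq> 0}" using g_supp by (intro bounded_subset[OF Fam_bdd[OF e'(1)]]) auto
    qed
    also have "\<dots> = summand 1 e + (\<Sum>j = 2..?d. summand j e)"
      using sum.atLeast_Suc_atMost[OF d, of "\<lambda>j. summand j e"] by (simp add: numeral_2_eq_2)
    also have "summand 1 e = e * Q (magnify F e (Fam e))"
    proof -
      \<comment> \<open>Nonnegativity of Theta_{d-1} makes its negative part vanish, so only the
        integral against \<open>N\<close> remains for \<open>j = 1\<close>.\<close>
      have "emeasure (Thn (?d - 1)) (space (Thn (?d - 1))) = 0"
        using sm unfolding support_measures_def by blast
      then have "AE xu in Thn (?d - 1). False"
        by (intro AE_I[of _ _ "space (Thn (?d - 1))"]) auto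
      then have "I (Thn (?d - 1)) 1 e = 0"
        unfolding I_def by (intro integral_eq_zero_AE) auto
      moreover have "I N 1 e = e * Q (magnify F e (A e))"
        using steiner_leading_term[OF fbar_meas h_int e'(2) A_borel[OF e'(1)] A_disj A_par[OF e'(1)]]
        by (simp add: I_def g_def Q_def M_def)
      ultimately show ?thesis by (simp add: summand_def N_def mag_A)
    qed
    finally show ?thesis .
  qed

  \<comment> \<open>Vanishing of the higher-order summands\<close>
  have summand_lim: "((\<lambda>e. summand j e / e) \<longlongrightarrow> 0) (at_right 0)" if j: "j \<in> {2..?d}" for j
  proof -
    \<comment> \<open>The factor \<open>T ^ j\<close> is split off from \<open>(e * T) ^ j\<close>.
      Dividing \<open>e ^ j\<close> by \<open>e\<close> leaves \<open>e ^ (j - 1)\<close>, which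
      tends to 0 because \<open>j \<ge> 2\<close>.\<close>
    define c where "c = real (?d - 1 choose (j - 1)) * T ^ j *
      ((\<integral>xu. fbar (fst xu) \<partial>Thp (?d - j)) + (\<integral>xu. fbar (fst xu) \<partial>Thn (?d - j)))"
    have i: "?d - j < ?d" using j d by auto
    have "\<forall>\<^sub>F e in at_right 0. norm (summand j e / e) \<le> c * e ^ (j - 1)"
      using in01
    proof eventually_elim
      case (elim e)
      have bnd: "\<bar>I P j e\<bar> \<le> (e * T) ^ j * (\<integral>xu. fbar (fst xu) \<partial>P)"
        if "space P = Nor F" "integrable P (\<lambda>xu. fbar (fst xu))" for P
        unfolding I_def g_def using that elim T_pos j
        by (intro steiner_term_bound cl F(2) fbar_nonneg A_par) auto
      have "\<bar>I (Thp (?d - j)) j e - I (Thn (?d - j)) j e\<bar> \<le> (e * T) ^ j *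
          ((\<integral>xu. fbar (fst xu) \<partial>Thp (?d - j)) + (\<integral>xu. fbar (fst xu) \<partial>Thn (?d - j)))"
        using bnd[of "Thp (?d - j)"] bnd[of "Thn (?d - j)"] support_measures_space[OF sm i] fbar_int[OF i]
        unfolding distrib_left by (intro order_trans[OF abs_triangle_ineq4] add_mono) auto
      then have "\<bar>summand j e\<bar> \<le> real (?d - 1 choose (j - 1)) * ((e * T) ^ j *
          ((\<integral>xu. fbar (fst xu) \<partial>Thp (?d - j)) + (\<integral>xu. fbar (fst xu) \<partial>Thn (?d - j))))"
        unfolding summand_def abs_mult by (simp add: mult_left_mono)
      also have "\<dots> = c * e ^ j" by (simp add: c_def power_mult_distrib)
      also have "\<dots> = c * e ^ (j - 1) * e" using j by (simp add: power_eq_if)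
      finally show ?case using elim by (simp add: field_simps)
    qed
    moreover have "((\<lambda>e. c * e ^ (j - 1)) \<longlongrightarrow> 0) (at_right 0)"
    proof -
      have "((\<lambda>e. c * e ^ (j - 1)) \<longlongrightarrow> c * 0 ^ (j - 1)) (at_right 0)" by (intro tendsto_intros)
      then show ?thesis using j by (simp add: power_0_left)
    qed
    ultimately show ?thesis by (rule Lim_null_comparison)
  qed

  \<comment> \<open>Replacing the density by its boundary values\<close>
  define R where "R e = (\<integral>\<^sup>+ z. ennreal (indicator {z. infdist z F \<le> e} z * \<bar>f z - fbar (proj F z)\<bar>) \<partial>lebesgue)" for e
  \<comment> \<open>The approximation hypothesis is needed at radius \<open>e * T\<close>, the width
    of the parallel set containing \<open>Fam e\<close>.\<close>
  have scale: "filterlim (\<lambda>e. e * T) (at_right 0) (at_right 0)"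
    unfolding mult.commute[of _ T] using filterlim_ident T_pos by (rule filterlim_times_pos) simp
  have RT: "((\<lambda>e. R (e * T) / ennreal (e * T)) \<longlongrightarrow> 0) (at_right 0)"
    using filterlim_compose[OF approx scale] by (simp add: R_def)
  \<comment> \<open>\<open>enn2real\<close> would send an infinite error to 0 and spoil the real
    bound below. A finite quotient forces finiteness, since \<open>top\<close> divided by a finite
    number is \<open>top\<close>.\<close>
  have R_fin: "\<forall>\<^sub>F e in at_right 0. R (e * T) < \<infinity>"
  proof -
    have "\<forall>\<^sub>F e in at_right 0. R (e * T) / ennreal (e * T) < \<infinity>"
      using order_tendstoD(2)[OF RT] by simp
    then show ?thesis
    proof eventually_elim
      case (elim e)
      then show ?case
        by (cases "R (e * T) = top") (auto simp: ennreal_top_divide less_top)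
    qed
  qed
  have R_lim: "((\<lambda>e. enn2real (R (e * T)) / e) \<longlongrightarrow> 0) (at_right 0)"
  proof -
    have "((\<lambda>e. T * enn2real (R (e * T) / ennreal (e * T))) \<longlongrightarrow> T * 0) (at_right 0)"
      using RT by (intro tendsto_intros) auto
    moreover have "\<forall>\<^sub>F e in at_right 0. T * enn2real (R (e * T) / ennreal (e * T)) = enn2real (R (e * T)) / e"
      using in01 by eventually_elim (use T_pos in \<open>simp add: enn2real_divide_ennreal\<close>)
    ultimately show ?thesis by (simp add: tendsto_cong)
  qed

  define P where "P e = measure (density lebesgue f) (Fam e)" for e
  have P_eq: "P e = (\<integral>z. indicator (A e) z * f z \<partial>lebesgue)" if e: "e \<in> {0..1}" for e
  proof -
    have [measurable]: "Fam e \<in> sets lebesgue" "A e \<in> sets lebesgue"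
      using Fam_borel[OF e] A_borel[OF e] by auto
    have "P e = (\<integral>z. indicator (Fam e) z * f z \<partial>lebesgue)"
      unfolding P_def using f_meas f_nonneg by (intro measure_density_eq_integral) auto
    also have "\<dots> = (\<integral>z. indicator (A e) z * f z \<partial>lebesgue)"
    proof (rule integral_cong_AE)
      show "AE z in lebesgue. indicator (Fam e) z * f z = indicator (A e) z * f z"
        using AE_K by eventually_elim (auto simp: A_def split: split_indicator)
    qed (use f_meas in measurable)
    finally show ?thesis .
  qed
  have P_0: "P 0 = 0"
  proof -
    have "A 0 = {}" using Fam0 by (auto simp: A_def)
    then show ?thesis using P_eq[of 0] by simp
  qed
  have P_diff: "\<bar>P e - (\<integral>z. g e z \<partial>lebesgue)\<bar> \<le> enn2real (R (e * T))"
    if e: "e \<in> {0<..<1}" and fin: "R (e * T) < \<infinity>" for e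
  proof -
    have e': "e \<in> {0..1}" using e by auto
    have A_leb: "A e \<in> sets lebesgue" using A_borel[OF e'] by simp
    have "integrable lborel (g e)"
    proof (rule Bochner_Integration.integrable_bound)
      have "emeasure lborel (Fam e) < \<infinity>" using Fam_bdd[OF e'] by (rule emeasure_bounded_finite)
      then show "integrable lborel (\<lambda>z. C * indicator (Fam e) z)"
        using Fam_borel[OF e'] by (intro integrable_mult_right integrable_real_indicator) auto
      have "norm (g e z) \<le> norm (C * indicator (Fam e) z)" for z
        using g_le[of e z] g_supp[of e z] by (cases "z \<in> Fam e") auto
      then show "AE z in lborel. norm (g e z) \<le> norm (C * indicator (Fam e) z)" by simp
      show "g e \<in> borel_measurable lborel" using g_borel[OF e'] by simp
    qed
    then have g_int: "integrable lebesgue (g e)" by (simp add: integrable_completion)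
    \<comment> \<open>Both functions carry the indicator of \<open>A e\<close>, whose points are
      within \<open>e * T\<close> of \<open>F\<close>, so the integrand of \<open>R (e * T)\<close>
      dominates.\<close>
    have "(\<integral>\<^sup>+z. ennreal \<bar>indicator (A e) z * f z - g e z\<bar> \<partial>lebesgue) \<le> R (e * T)"
      unfolding R_def using A_par[OF e']
      by (intro nn_integral_mono ennreal_leI) (auto simp: g_def parallel_set_def split: split_indicator)
    moreover have "(\<lambda>z. indicator (A e) z * f z) \<in> borel_measurable lebesgue"
      using f_meas A_leb by (intro borel_measurable_times borel_measurable_indicator)
    ultimately show ?thesis
      unfolding P_eq[OF e'] using g_int fin by (intro abs_integral_diff_le_enn2real)
  qed

  \<comment> \<open>Assembling the difference quotient\<close>
  define E where "E e = (P e - (\<integral>z. g e z \<partial>lebesgue)) / e" for e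
  have E_lim: "(E \<longlongrightarrow> 0) (at_right 0)"
  proof (rule Lim_null_comparison[OF _ R_lim])
    show "\<forall>\<^sub>F e in at_right 0. norm (E e) \<le> enn2real (R (e * T)) / e"
      using in01 R_fin
    proof eventually_elim
      case (elim e)
      then show ?case using P_diff[of e] by (simp add: E_def divide_right_mono)
    qed
  qed
  have "((\<lambda>e. E e + Q (magnify F e (Fam e)) + (\<Sum>j = 2..?d. summand j e / e)) \<longlongrightarrow>
      0 + Q B + (\<Sum>j = 2..?d. 0)) (at_right 0)"
    by (intro tendsto_add tendsto_sum E_lim Q_lim summand_lim)
  moreover have "\<forall>\<^sub>F e in at_right 0. E e + Q (magnify F e (Fam e)) + (\<Sum>j = 2..?d. summand j e / e) = (P e - P 0) / e"
    using in01
  proof eventually_elim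
    case (elim e)
    then show ?case using steiner[of e]
      by (simp add: E_def P_0 sum_divide_distrib[symmetric] diff_divide_distrib add_divide_distrib)
  qed
  ultimately have "((\<lambda>e. (P e - P 0) / e) \<longlongrightarrow> Q B) (at_right 0)" by (simp add: tendsto_cong)
  then show ?thesis unfolding Q_B P_def .
qed

end
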